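(* Let $n\geq 0$ and $m\geq 1$ be integers and let $p$ be a prime with $p\nmid m$. Then, as polynomials in $x$ (coefficientwise modulo $p$), $$x^{m}\sum_{k=1}^{p-1}\frac{\mathcal{B}_{n+k}(x)}{(-m)^{k}} \equiv x^p\sum_{k=0}^{n}S(n,k)(-1)^{m+k-1}\mathcal{D}_{m+k-1}(1-x) \pmod{p},$$ or equivalently $$x^{m}\sum_{j=0}^{n}s(n,j)\sum_{k=1}^{p-1}\frac{\mathcal{B}_{j+k}(x)}{(-m)^{k}} \equiv (-1)^{m+n-1}x^{p}\mathcal{D}_{m+n-1}(1-x) \pmod{p}.$$
   Context: The Stirling numbers of the first kind $s(m,j)$ (signed) and of the second kind $S(m,j)$ are defined by $x(x-1)\cdots(x-m+1)=\sum_{j=0}^m s(m,j)x^j$ and $\sum_{j=0}^m S(m,j)\,x(x-1)\cdots(x-j+1)=x^m$. The Bell polynomials are $\mathcal{B}_m(x)=\sum_{j=0}^m S(m,j)x^j$. The derangement polynomials are $\mathcal{D}_m(x)=\sum_{j=0}^m\binom{m}{j}j!\,(x-1)^{m-j}$. The quantities $1/(-m)^k$ are rationals with denominator prime to $p$ (equivalently, inverses of $-m$ modulo $p$); for polynomials $P(x),Q(x)$ with such coefficients, $P(x)\equiv Q(x)\pmod p$ means that corresponding coefficients are congruent modulo $p$. *)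

theory Defs
  imports "HOL-Computational_Algebra.Computational_Algebra" "HOL-Combinatorics.Stirling"
begin

definition ffact_poly :: "nat \<Rightarrow> 'a::comm_ring_1 poly" where
  "ffact_poly m = (\<Prod>i<m. [:- of_nat i, 1:])"

(* The library's stirling is unsigned; see signed_stirling_eq_stirling below. *)
definition signed_stirling :: "nat \<Rightarrow> nat \<Rightarrow> int" where
  "signed_stirling m j = coeff (ffact_poly m) j"

definition bell_poly :: "nat \<Rightarrow> 'a::comm_ring_1 poly" where
  "bell_poly m = (\<Sum>j\<le>m. monom (of_nat (Stirling m j)) j)"

definition derangement_poly :: "nat \<Rightarrow> 'a::comm_ring_1 poly" where
  "derangement_poly m = (\<Sum>j\<le>m. of_nat ((m choose j) * fact j) * [:-1, 1:] ^ (m - j))"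

(* quotient_of yields the reduced fraction (numerator, positive denominator). *)
definition rat_p_integral :: "nat \<Rightarrow> rat \<Rightarrow> bool" where
  "rat_p_integral p r \<longleftrightarrow> coprime (snd (quotient_of r)) (int p)"

(* Congruence modulo p in the ring of rationals with denominator prime to p;
   membership of both sides in that ring is part of the relation. *)
definition rat_cong :: "nat \<Rightarrow> rat \<Rightarrow> rat \<Rightarrow> bool" where
  "rat_cong p a b \<longleftrightarrow> rat_p_integral p a \<and> rat_p_integral p b \<and>
     int p dvd fst (quotient_of (a - b))"

definition poly_cong :: "nat \<Rightarrow> rat poly \<Rightarrow> rat poly \<Rightarrow> bool" where
  "poly_cong p P Q \<longleftrightarrow> (\<forall>i. rat_cong p (coeff P i) (coeff Q i))"

lemma ffact_poly_Suc: "ffact_poly (Suc m) = ffact_poly m * [:- of_nat m, 1:]"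
  by (simp add: ffact_poly_def mult.commute)

lemma degree_ffact_poly: "degree (ffact_poly m :: 'a::idom poly) = m"
  unfolding ffact_poly_def by (subst degree_prod_sum_eq) auto

lemma ffact_poly_eq_sum_signed_stirling:
  "ffact_poly m = (\<Sum>j\<le>m. monom (signed_stirling m j) j)"
  using poly_as_sum_of_monoms[of "ffact_poly m :: int poly"]
  by (simp add: signed_stirling_def degree_ffact_poly)

lemma signed_stirling_Suc:
  "signed_stirling (Suc m) j =
     (if j = 0 then 0 else signed_stirling m (j - 1)) - int m * signed_stirling m j"
  by (cases j) (simp_all add: signed_stirling_def ffact_poly_Suc coeff_pCons)

lemma signed_stirling_eq_stirling:
  "signed_stirling m j = (-1) ^ (m - j) * int (stirling m j)"
proof (induction m arbitrary: j)
  case 0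
  then show ?case
    by (cases j) (simp_all add: signed_stirling_def ffact_poly_def)
next
  case (Suc m)
  show ?case
  proof (cases j)
    case 0
    then show ?thesis
      by (cases "m = 0") (simp_all add: signed_stirling_Suc Suc.IH)
  next
    case (Suc i)
    show ?thesis
    proof (cases "i < m")
      case True
      then have "m - i = Suc (m - Suc i)"
        by simp
      then show ?thesis
        by (simp add: Suc signed_stirling_Suc Suc.IH algebra_simps)
    next
      case False
      then show ?thesis
        by (simp add: Suc signed_stirling_Suc Suc.IH)
    qed
  qed
qed

lemma sum_Stirling_ffact_poly:
  "(\<Sum>j\<le>m. of_nat (Stirling m j) * ffact_poly j) = (monom 1 m :: 'a::comm_ring_1 poly)"
proof (induction m)
  case 0
  then show ?case
    by (simp add: ffact_poly_def)
next
  case (Suc m)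
  let ?f = "ffact_poly :: nat \<Rightarrow> 'a poly"
  let ?g = "\<lambda>j. of_nat (j * Stirling m j) * ?f j"
  have X: "[:- of_nat j, 1:] + of_nat j = ([:0, 1:] :: 'a poly)" for j
    by (simp add: of_nat_poly)
  have step: "[:0, 1:] * ?f j = ?f (Suc j) + of_nat j * ?f j" for j
    unfolding ffact_poly_Suc X[of j, symmetric] by (simp only: algebra_simps)
  have shift: "(\<Sum>j\<le>m. ?g (Suc j)) = (\<Sum>j\<le>m. ?g j)"
    using sum.atMost_Suc[of ?g m] sum.atMost_Suc_shift[of ?g m] by simp
  have "monom 1 (Suc m) = [:0, 1:] * (\<Sum>j\<le>m. of_nat (Stirling m j) * ?f j)"
    by (simp add: Suc.IH monom_Suc)
  also have "\<dots> = (\<Sum>j\<le>m. of_nat (Stirling m j) * ([:0, 1:] * ?f j))"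
    by (simp only: sum_distrib_left mult.left_commute)
  also have "\<dots> = (\<Sum>j\<le>m. of_nat (Stirling m j) * ?f (Suc j)) + (\<Sum>j\<le>m. ?g j)"
    unfolding step by (simp add: sum.distrib algebra_simps)
  also have "\<dots> = (\<Sum>j\<le>m. of_nat (Stirling (Suc m) (Suc j)) * ?f (Suc j))"
    unfolding shift[symmetric] sum.distrib[symmetric] by (simp add: algebra_simps)
  also have "\<dots> = (\<Sum>j\<le>Suc m. of_nat (Stirling (Suc m) j) * ?f j)"
    by (simp only: sum.atMost_Suc_shift) simp
  finally show ?case
    by simp
qed

end

theory Submission
  imports Defs "HOL-Number_Theory.Residues"
begin

text \<open>
  Umbral calculus: let $L$ be the linear map on polynomials in $t$ with $L(t^i) = \mathcal{B}_i(x)$.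
  Writing $(t)_j$ for the falling factorial, $L((t)_j) = x^j$, hence
  $L((t)_r f(t - r)) = x^r L(f)$ for every $f$. Clearing the denominator $d = (-m)^{p-1} \equiv 1$,
  the inner sum becomes $G(t) = \sum_{k=1}^{p-1} (-m)^{p-1-k} t^k$, a geometric sum with
  $(t + m) G(t) = t^p - d t \equiv (t)_p$ modulo $p$. With $M = m + n - 1$ we have
  $(t)_{m+n} = t (t - 1)_M$, and $(t - m)_p \equiv (t)_p$, so
  \[ x^m L((t)_n G(t)) = L((t)_{m+n} G(t - m)) \equiv L((t)_p (t - 1)_M)
      \equiv x^p L((t - 1)_M), \]
  and $L((t - 1)_M) = (-1)^M \mathcal{D}_M(1 - x)$ since both sides satisfy
  $E_M = x^M - M E_{M-1}$. This is the second congruence; the first one follows by expanding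
  $t^n = \sum_k S(n,k) (t)_k$.
\<close>

hide_const (open) up_ring.coeff up_ring.monom module.smult

section \<open>The umbral map and the falling factorials\<close>

lemma smult_sum_right: "smult c (sum f A) = (\<Sum>a\<in>A. smult c (f a))"
  by (induction A rule: infinite_finite_induct) (simp_all add: smult_add_right)

text \<open>The map L. Argument and result have the same type, but the variable of the argument is t
  and that of the result is x.\<close>

definition bell_umbra :: "'a::comm_ring_1 poly \<Rightarrow> 'a poly" where
  "bell_umbra f = (\<Sum>i\<le>degree f. smult (coeff f i) (bell_poly i))"

text \<open>A bound other than the degree lets polynomials of different degrees be summed over one
  range, which gives additivity.\<close>

lemma bell_umbra_eq:
  assumes "degree f \<le> N"
  shows "bell_umbra f = (\<Sum>i\<le>N. smult (coeff f i) (bell_poly i))"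
  unfolding bell_umbra_def
  by (rule sum.mono_neutral_left) (use assms in \<open>auto simp: coeff_eq_0\<close>)

lemma bell_umbra_add: "bell_umbra (f + g) = bell_umbra f + bell_umbra g"
proof -
  let ?N = "max (degree f) (degree g)"
  have "degree (f + g) \<le> ?N" by (rule degree_add_le_max)
  then show ?thesis
    by (simp add: bell_umbra_eq[of _ ?N] smult_add_left sum.distrib)
qed

lemma bell_umbra_0 [simp]: "bell_umbra 0 = 0"
  by (simp add: bell_umbra_def)

lemma bell_umbra_smult: "bell_umbra (smult c f) = smult c (bell_umbra f)"
  using degree_smult_le[of c f]
  by (simp add: bell_umbra_eq[of _ "degree f"] smult_sum_right)

lemma bell_umbra_diff: "bell_umbra (f - g) = bell_umbra f - bell_umbra g"
  using bell_umbra_add[of "f - g" g] by simp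

lemma bell_umbra_sum: "bell_umbra (sum f A) = (\<Sum>a\<in>A. bell_umbra (f a))"
  by (induction A rule: infinite_finite_induct) (simp_all add: bell_umbra_add)

lemma bell_umbra_monom: "bell_umbra (monom 1 n) = bell_poly n"
proof -
  have "bell_umbra (monom 1 n) = (\<Sum>i\<le>n. smult (coeff (monom 1 n) i) (bell_poly i :: 'a poly))"
    by (rule bell_umbra_eq) (rule degree_monom_le)
  also have "\<dots> = (\<Sum>i\<le>n. if i = n then bell_poly n else 0)"
    by (intro sum.cong) auto
  finally show ?thesis by simp
qed

text \<open>Congruence modulo c is expressed as divisibility of a difference by the constant
  \<open>[:c:]\<close>; being linear, L respects it.\<close>

lemma bell_umbra_dvd:
  assumes "[:c:] dvd f"
  shows "[:c:] dvd bell_umbra f"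
proof -
  obtain g where "f = smult c g" using assms by (auto elim!: dvdE)
  then have "bell_umbra f = [:c:] * bell_umbra g" by (simp add: bell_umbra_smult)
  then show ?thesis by (metis dvd_triv_left)
qed

text \<open>Apply L to the expansion of t^m in falling factorials, where S(m,m) = 1. By induction
  the terms below the top one match those of \<open>bell_poly m\<close>, which leaves x^m for the
  image of (t)_m.\<close>

lemma bell_umbra_ffact: "bell_umbra (ffact_poly j) = (monom 1 j :: 'a::comm_ring_1 poly)"
proof (induction j rule: less_induct)
  case (less m)
  let ?S = "\<lambda>j. of_nat (Stirling m j) :: 'a"
  have of_nat_mult_poly: "of_nat c * f = smult (of_nat c) f" for c and f :: "'a poly"
    by (simp add: of_nat_poly)
  have "monom 1 m = (\<Sum>j<m. smult (?S j) (ffact_poly j)) + ffact_poly m"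
    by (simp add: sum_Stirling_ffact_poly[symmetric] of_nat_mult_poly lessThan_Suc_atMost[symmetric])
  then have "bell_poly m = bell_umbra ((\<Sum>j<m. smult (?S j) (ffact_poly j)) + ffact_poly m)"
    by (simp add: bell_umbra_monom[symmetric])
  also have "\<dots> = (\<Sum>j<m. monom (?S j) j) + bell_umbra (ffact_poly m)"
    by (simp add: bell_umbra_add bell_umbra_sum bell_umbra_smult less.IH smult_monom)
  also have "bell_poly m = (\<Sum>j<m. monom (?S j) j) + monom 1 m"
    by (simp add: bell_poly_def lessThan_Suc_atMost[symmetric])
  finally show ?case by simp
qed

text \<open>Reduces linear claims about all polynomials to falling factorials: each t^i is expanded
  with Stirling numbers of the second kind.\<close>

lemma ffact_poly_span:
  fixes f :: "'a::comm_ring_1 poly"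
  shows "\<exists>N c. f = (\<Sum>j\<le>(N::nat). smult (c j) (ffact_poly j))"
proof (intro exI)
  let ?N = "degree f"
  have "f = (\<Sum>i\<le>?N. smult (coeff f i) (monom 1 i))"
    by (simp add: smult_monom poly_as_sum_of_monoms)
  also have "\<dots> = (\<Sum>i\<le>?N. \<Sum>j\<le>?N. smult (coeff f i * of_nat (Stirling i j)) (ffact_poly j))"
  proof (rule sum.cong[OF refl])
    fix i assume i: "i \<in> {..?N}"
    have "smult (coeff f i) (monom 1 i)
        = (\<Sum>j\<le>i. smult (coeff f i * of_nat (Stirling i j)) (ffact_poly j))"
      by (simp add: sum_Stirling_ffact_poly[symmetric] smult_sum_right of_nat_poly)
    \<comment> \<open>The range can be padded because S(i,j) = 0 for j > i.\<close>
    also have "\<dots> = (\<Sum>j\<le>?N. smult (coeff f i * of_nat (Stirling i j)) (ffact_poly j))"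
      by (rule sum.mono_neutral_left) (use i in auto)
    finally show "smult (coeff f i) (monom 1 i) = \<dots>" .
  qed
  also have "\<dots> = (\<Sum>j\<le>?N. smult (\<Sum>i\<le>?N. coeff f i * of_nat (Stirling i j)) (ffact_poly j))"
    by (subst sum.swap) (simp add: smult_sum)
  finally show "f = (\<Sum>j\<le>?N. smult ((\<lambda>j. \<Sum>i\<le>?N. coeff f i * of_nat (Stirling i j)) j) (ffact_poly j))"
    by simp
qed

lemma ffact_poly_add:
  "ffact_poly (m + n) = ffact_poly m * pcompose (ffact_poly n) [:- of_nat m, 1:]"
proof (induction n)
  case 0
  then show ?case by (simp add: ffact_poly_def pcompose_1)
next
  case (Suc n)
  have "[:- of_nat (m + n), 1:] = pcompose [:- of_nat n, 1:] [:- of_nat m, 1 :: 'a:]"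
    by (simp add: pcompose_pCons)
  then show ?case
    by (simp only: add_Suc_right ffact_poly_Suc Suc.IH pcompose_mult mult.assoc)
qed

text \<open>For f = (t)_j the argument on the left is (t)_{r+j} and both sides are x^(r+j);
  linearity gives every f.\<close>

lemma bell_umbra_shift:
  fixes f :: "'a::comm_ring_1 poly"
  shows "bell_umbra (ffact_poly r * pcompose f [:- of_nat r, 1:]) = monom 1 r * bell_umbra f"
proof -
  obtain N c where f: "f = (\<Sum>j\<le>(N::nat). smult (c j) (ffact_poly j))"
    using ffact_poly_span by blast
  show ?thesis
    unfolding f
    by (simp add: pcompose_sum pcompose_smult sum_distrib_left bell_umbra_sum bell_umbra_smult
        ffact_poly_add[symmetric] bell_umbra_ffact mult_monom)
qed

section \<open>Reflected derangement polynomials\<close>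

text \<open>The sign makes the polynomial monic and gives it the recurrence stated for E_M.\<close>

definition reflected_derangement_poly :: "nat \<Rightarrow> 'a::comm_ring_1 poly" where
  "reflected_derangement_poly m = smult ((-1) ^ m) (pcompose (derangement_poly m) [:1, -1:])"

text \<open>Substituting 1 - x turns x - 1 into -x, so every summand becomes a monomial and only j =
  m - i contributes to x^i.\<close>

lemma coeff_reflected_derangement_poly:
  "coeff (reflected_derangement_poly m) i =
     (if i \<le> m then of_nat ((m choose i) * fact (m - i)) * (-1) ^ (m - i) else (0::'a::comm_ring_1))"
proof -
  have X: "pcompose [:-1, 1:] [:1, -1:] = (monom (-1) 1 :: 'a poly)"
    by (simp add: pcompose_pCons monom_altdef)
  have pow: "pcompose (q ^ k) r = pcompose q r ^ k" for q r :: "'a poly" and k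
    by (induction k) (simp_all add: pcompose_mult pcompose_1)
  have "pcompose (of_nat c * [:-1, 1:] ^ k) [:1, -1:] = (monom (of_nat c * (-1) ^ k) k :: 'a poly)" for c k
    by (simp add: of_nat_poly pcompose_smult pow X monom_power smult_monom)
  then have "coeff (reflected_derangement_poly m :: 'a poly) i
      = (-1) ^ m * (\<Sum>j\<le>m. coeff (monom (of_nat ((m choose j) * fact j) * (-1) ^ (m - j)) (m - j)) i)"
    by (simp only: reflected_derangement_poly_def derangement_poly_def pcompose_sum coeff_smult coeff_sum)
  also have "\<dots> = (-1) ^ m * (\<Sum>j\<le>m. if m - j = i then of_nat ((m choose j) * fact j) * (-1) ^ i else 0)"
    by (intro arg_cong[where f = "(*) _"] sum.cong) auto
  also have "(\<Sum>j\<le>m. if m - j = i then of_nat ((m choose j) * fact j) * (-1) ^ i else (0::'a))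
      = (\<Sum>j\<le>m. if j = m - i then (if i \<le> m then of_nat ((m choose j) * fact j) * (-1) ^ i else 0) else 0)"
  proof (rule sum.cong[OF refl])
    fix j assume "j \<in> {..m}"
    then have "m - j = i \<longleftrightarrow> j = m - i \<and> i \<le> m" by auto
    then show "(if m - j = i then of_nat ((m choose j) * fact j) * (-1) ^ i else (0::'a))
        = (if j = m - i then (if i \<le> m then of_nat ((m choose j) * fact j) * (-1) ^ i else 0) else 0)"
      by (cases "i \<le> m"; cases "j = m - i") simp_all
  qed
  also have "\<dots> = (if i \<le> m then of_nat ((m choose (m - i)) * fact (m - i)) * (-1) ^ i else 0)"
    by (simp only: sum.delta finite_atMost atMost_iff diff_le_self if_True)
  also have "(-1) ^ m * \<dots> =
      (if i \<le> m then of_nat ((m choose i) * fact (m - i)) * (-1) ^ (m - i) else 0)"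
  proof (cases "i \<le> m")
    case True
    have "(-1::'a) ^ m = (-1) ^ (m - i) * (-1) ^ i"
      using True by (simp flip: power_add)
    moreover have "((-1::'a) ^ i) * ((-1) ^ i) = 1"
      by (simp flip: power_mult_distrib)
    ultimately have "(-1) ^ m * (c * (-1) ^ i) = c * (-1) ^ (m - i)" for c :: 'a
      by (simp add: algebra_simps)
    then show ?thesis
      using True by (simp only: binomial_symmetric[OF True, symmetric] if_True)
  qed simp
  finally show ?thesis .
qed

text \<open>Up to sign the coefficient of x^i is m!/i!. Going to m + 1 multiplies it by -(m + 1),
  and only the top term x^(m+1) is new.\<close>

lemma reflected_derangement_poly_Suc:
  "reflected_derangement_poly (Suc m) = monom 1 (Suc m) - of_nat (Suc m) * reflected_derangement_poly m"
proof (rule poly_eqI)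
  fix i
  show "coeff (reflected_derangement_poly (Suc m)) i
      = coeff (monom 1 (Suc m) - of_nat (Suc m) * reflected_derangement_poly m :: 'a poly) i"
  proof (cases "i \<le> m")
    case True
    have "(Suc m choose i) * fact (Suc m - i) = Suc m * ((m choose i) * fact (m - i))"
    proof -
      have "fact i * ((Suc m choose i) * fact (Suc m - i)) = fact (Suc m)"
        using binomial_fact_lemma[of i "Suc m"] True by (simp add: mult_ac)
      also have "\<dots> = Suc m * (fact i * ((m choose i) * fact (m - i)))"
        using binomial_fact_lemma[of i m] True by (simp add: mult_ac)
      finally have "fact i * ((Suc m choose i) * fact (Suc m - i))
          = fact i * (Suc m * ((m choose i) * fact (m - i)))"
        by (simp only: mult.left_commute)
      then show ?thesis by simp
    qed
    then have *: "(of_nat ((Suc m choose i) * fact (Suc m - i)) :: 'a)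
        = of_nat (Suc m) * of_nat ((m choose i) * fact (m - i))"
      by (simp only: of_nat_mult)
    have "coeff (monom 1 (Suc m) - of_nat (Suc m) * reflected_derangement_poly m :: 'a poly) i
        = - (of_nat (Suc m) * coeff (reflected_derangement_poly m) i)"
      using True by (simp add: of_nat_poly algebra_simps)
    moreover have "of_nat (Suc m) * c * (-1) ^ Suc k = - (of_nat (Suc m) * (c * (-1) ^ k))"
      for c :: 'a and k
      by (simp add: algebra_simps)
    ultimately show ?thesis
      using True * by (simp only: coeff_reflected_derangement_poly Suc_diff_le le_SucI if_True)
  qed (auto simp: coeff_reflected_derangement_poly of_nat_poly)
qed

text \<open>In (t)_{m+1} = t (t-1)_m write t as (t - (m+1)) + (m+1). The first part completes
  (t-1)_m to (t-1)_{m+1}, so L yields the recurrence of the reflected derangement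
  polynomials.\<close>

lemma bell_umbra_ffact_pred:
  "bell_umbra (pcompose (ffact_poly m) [:-1, 1:]) = reflected_derangement_poly m"
proof (induction m)
  case 0
  show ?case
    using bell_umbra_ffact[of 0, where ?'a = 'a]
    by (simp add: ffact_poly_def reflected_derangement_poly_def derangement_poly_def pcompose_1)
next
  case (Suc m)
  let ?g = "\<lambda>m. pcompose (ffact_poly m) [:-1, 1:] :: 'a poly"
  have "ffact_poly (Suc m) = [:0, 1:] * ?g m"
    using ffact_poly_add[of 1 m, where ?'a = 'a] by (simp add: ffact_poly_def)
  also have "\<dots> = ?g m * [:- of_nat (Suc m), 1:] + smult (of_nat (Suc m)) (?g m)"
  proof -
    have "[:0, 1:] * h = h * [:- c, 1:] + smult c h" for h :: "'a poly" and c
      by simp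
    then show ?thesis .
  qed
  also have "?g m * [:- of_nat (Suc m), 1:] = ?g (Suc m)"
  proof -
    have "[:- of_nat (Suc m), 1:] = pcompose [:- of_nat m, 1:] [:-1, 1 :: 'a:]"
      by (simp add: pcompose_pCons)
    then show ?thesis by (simp only: ffact_poly_Suc pcompose_mult)
  qed
  finally have eq: "ffact_poly (Suc m) = ?g (Suc m) + smult (of_nat (Suc m)) (?g m)" .
  have "monom 1 (Suc m) = bell_umbra (ffact_poly (Suc m) :: 'a poly)"
    by (simp only: bell_umbra_ffact)
  also have "\<dots> = bell_umbra (?g (Suc m)) + smult (of_nat (Suc m)) (reflected_derangement_poly m)"
    by (subst eq) (simp only: bell_umbra_add bell_umbra_smult Suc.IH)
  finally have "monom 1 (Suc m) = bell_umbra (?g (Suc m)) + smult (of_nat (Suc m)) (reflected_derangement_poly m)" .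
  then show ?case
    unfolding reflected_derangement_poly_Suc by (simp add: of_nat_poly)
qed

section \<open>Congruences under composition, and Fermat's theorem\<close>

lemma const_poly_dvd_pcompose:
  assumes "[:c:] dvd f"
  shows "[:c:] dvd pcompose f q"
proof -
  obtain g where "f = [:c:] * g" using assms by (elim dvdE)
  then have "pcompose f q = [:c:] * pcompose g q" by (simp add: pcompose_smult)
  then show ?thesis by (metis dvd_triv_left)
qed

text \<open>Horner's scheme: the difference for \<open>pCons a f\<close> is a multiple of
  \<open>q - r\<close> plus a multiple of the difference for \<open>f\<close>.\<close>

lemma pcompose_const_dvd_diff:
  fixes q r :: "'a::comm_ring_1 poly"
  assumes "[:c:] dvd q - r"
  shows "[:c:] dvd pcompose f q - pcompose f r"
proof (induction f)
  case 0
  then show ?case by simp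
next
  case (pCons a f)
  have "pcompose (pCons a f) q - pcompose (pCons a f) r
      = (q - r) * pcompose f q + r * (pcompose f q - pcompose f r)"
    by (simp add: pcompose_pCons algebra_simps)
  then show ?case
    using assms pCons.IH by simp
qed

text \<open>The base -m is negative, hence the integer form; the residue \<open>b\<close> brings the
  claim back to natural numbers.\<close>

lemma fermat_theorem_int:
  fixes a :: int
  assumes "prime p" and "\<not> int p dvd a"
  shows "[a ^ (p - 1) = 1] (mod int p)"
proof -
  define b where "b = nat (a mod int p)"
  have b: "int b = a mod int p"
    using assms(1) by (simp add: b_def prime_gt_0_nat)
  then have "[int b = a] (mod int p)" by simp
  then have "\<not> int p dvd int b" using assms(2) by (simp add: cong_dvd_iff[OF cong_sym])
  then have "[b ^ (p - 1) = 1] (mod p)"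
    using assms(1) by (intro fermat_theorem) simp_all
  then have "[int b ^ (p - 1) = 1] (mod int p)"
    by (metis cong_int_iff of_nat_1 of_nat_power)
  with \<open>[int b = a] (mod int p)\<close> show ?thesis
    by (metis cong_pow cong_sym cong_trans)
qed

lemma prime_dvd_power_diff_self:
  fixes a :: int
  assumes "prime p"
  shows "int p dvd a ^ p - a"
proof -
  have "a ^ p = a * a ^ (p - 1)"
    using assms by (simp add: prime_gt_0_nat power_eq_if)
  then have "a ^ p - a = a * (a ^ (p - 1) - 1)"
    by (simp add: right_diff_distrib)
  then show ?thesis
    using fermat_theorem_int[OF assms, of a]
    by (cases "int p dvd a") (simp_all add: cong_iff_dvd_diff)
qed

section \<open>Falling factorials modulo a prime\<close>

lemma poly_ffact_of_nat_eq_0: "k < j \<Longrightarrow> poly (ffact_poly j) (of_nat k) = 0"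
  by (auto simp: ffact_poly_def poly_prod intro!: prod_zero)

lemma poly_ffact_self: "poly (ffact_poly k) (of_nat k) = fact k"
proof -
  have "poly (ffact_poly k) (of_nat k :: 'a) = (\<Prod>i<k. of_nat (k - i))"
    by (auto simp: ffact_poly_def poly_prod of_nat_diff intro!: prod.cong)
  also have "\<dots> = of_nat (\<Prod>i<k. k - i)" by simp
  also have "(\<Prod>i<k. k - i) = fact k"
    by (simp add: fact_prod_rev atLeast0LessThan)
  finally show ?thesis by simp
qed

text \<open>
  Evaluating $t^p = \sum_j S(p,j) (t)_j$ at $t = k$ leaves $k^p \equiv k + S(p,k)\, k!$ modulo $p$
  if $S(p,j) \equiv 0$ for $2 \le j < k$.
\<close>

lemma prime_dvd_Stirling:
  assumes "prime p" and "2 \<le> k" and "k < p"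
  shows "p dvd Stirling p k"
  using assms(2,3)
proof (induction k rule: less_induct)
  case (less k)
  let ?h = "\<lambda>j. int (Stirling p j) * poly (ffact_poly j) (int k)"
  have "int k ^ p = poly (\<Sum>j\<le>p. of_nat (Stirling p j) * ffact_poly j) (int k)"
    unfolding sum_Stirling_ffact_poly by (simp add: poly_monom)
  also have "\<dots> = (\<Sum>j\<le>p. ?h j)"
    by (simp add: poly_sum)
  \<comment> \<open>The terms with j > k vanish because (k)_j = 0.\<close>
  also have "\<dots> = (\<Sum>j\<le>k. ?h j)"
    by (rule sum.mono_neutral_right) (use less.prems poly_ffact_of_nat_eq_0[of k, where ?'a=int] in auto)
  also have "{..k} = insert 0 (insert 1 (insert k {2..<k}))"
    using less.prems by auto
  also have "sum ?h \<dots> = ?h 0 + (?h 1 + (?h k + sum ?h {2..<k}))"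
    using less.prems by simp
  also have "?h 0 = 0" using less.prems by (cases p) simp_all
  also have "?h 1 = int k"
    using less.prems by (cases p) (simp_all add: ffact_poly_def del: Stirling.simps(4))
  also have "?h k = int (Stirling p k * fact k)"
    using poly_ffact_self[of k, where ?'a = int] by simp
  finally have eq: "int (Stirling p k * fact k) = (int k ^ p - int k) - sum ?h {2..<k}"
    by simp
  have "int p dvd ?h j" if "j \<in> {2..<k}" for j
    using less.IH[of j] less.prems that by (intro dvd_mult2) auto
  then have "int p dvd sum ?h {2..<k}" by (rule dvd_sum)
  then have "int p dvd int (Stirling p k * fact k)"
    unfolding eq using prime_dvd_power_diff_self[OF assms(1), of "int k"] by (rule dvd_diff[rotated])
  then have "p dvd Stirling p k * fact k" by (simp only: int_dvd_int_iff)
  \<comment> \<open>As k < p, the factor k! is prime to p and can be cancelled.\<close>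
  moreover have "\<not> p dvd fact k"
    using less.prems assms(1) by (simp add: prime_dvd_fact_iff)
  ultimately show ?case using assms(1) by (simp add: prime_dvd_mult_iff)
qed

text \<open>In the expansion of t^p the coefficients S(p,j) with 2 \<le> j < p vanish modulo p. What
  remains is t + (t)_p, since S(p,0) = 0 and S(p,1) = S(p,p) = 1.\<close>

lemma ffact_poly_prime_dvd:
  assumes "prime p"
  shows "[:int p:] dvd (monom 1 p - monom 1 1) - ffact_poly p"
proof -
  let ?h = "\<lambda>j. of_nat (Stirling p j) * ffact_poly j :: int poly"
  have p: "p \<ge> 2" using assms by (rule prime_ge_2_nat)
  have "monom 1 p = sum ?h {..p}" by (simp add: sum_Stirling_ffact_poly)
  also have "{..p} = insert 0 (insert 1 (insert p {2..<p}))"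
    using p by auto
  also have "sum ?h \<dots> = ?h 0 + (?h 1 + (?h p + sum ?h {2..<p}))"
    using p by simp
  also have "?h 0 = 0" using p by (cases p) simp_all
  also have "?h 1 = monom 1 1"
    using p by (cases p) (simp_all add: ffact_poly_def monom_altdef del: Stirling.simps(4))
  finally have eq: "(monom 1 p - monom 1 1) - ffact_poly p = sum ?h {2..<p}"
    by simp
  have "[:int p:] dvd ?h j" if "j \<in> {2..<p}" for j
    using prime_dvd_Stirling[OF assms, of j] that
    by (intro dvd_mult2) (auto simp: of_nat_poly)
  then show ?thesis unfolding eq by (rule dvd_sum)
qed

text \<open>One step of the shift: $t (t-1)_p = (t)_{p+1} = (t)_p (t - p) \equiv t (t)_p$.\<close>

lemma ffact_poly_shift_dvd:
  "[:int p:] dvd pcompose (ffact_poly p) [:- of_nat m, 1:] - ffact_poly p"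
proof (induction m)
  case 0
  then show ?case by (simp add: pcompose_idR)
next
  case (Suc m)
  let ?D = "pcompose (ffact_poly p) [:-1, 1:] - ffact_poly p :: int poly"
  have "ffact_poly (1 + p) = ffact_poly (Suc p)" by simp
  then have "[:0, 1:] * pcompose (ffact_poly p) [:-1, 1:] = ffact_poly p * [:- int p, 1:]"
    unfolding ffact_poly_add ffact_poly_Suc by (simp add: ffact_poly_def)
  then have "[:0, 1:] * ?D = ffact_poly p * [:- int p, 1:] - [:0, 1:] * ffact_poly p"
    by (simp only: right_diff_distrib)
  also have "\<dots> = [:int p:] * (- ffact_poly p)" by simp
  finally have "[:int p:] dvd [:0, 1:] * ?D" by (metis dvd_triv_left)
  \<comment> \<open>Multiplication by t only shifts the coefficients, so their divisibility passes
    to \<open>?D\<close>.\<close>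
  then have "[:int p:] dvd pCons 0 ?D" by simp
  then have "[:int p:] dvd ?D"
    unfolding const_poly_dvd_iff by (metis coeff_pCons_Suc)
  \<comment> \<open>Substituting t - m in \<open>?D\<close> compares the shifts by m + 1 and by m,
    the difference that the induction adds.\<close>
  then have "[:int p:] dvd pcompose ?D [:- of_nat m, 1:]"
    by (rule const_poly_dvd_pcompose)
  also have "pcompose ?D [:- of_nat m, 1:]
      = pcompose (ffact_poly p) [:- of_nat (Suc m), 1:] - pcompose (ffact_poly p) [:- of_nat m, 1:]"
    by (simp add: pcompose_diff pcompose_assoc[symmetric] pcompose_pCons)
  finally show ?case
    by (rule dvd_add[OF _ Suc.IH, THEN back_subst[of "(dvd) _"]]) simp
qed

section \<open>The geometric sum and the congruences over the integers\<close>

definition geom_poly :: "nat \<Rightarrow> nat \<Rightarrow> int poly" where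
  "geom_poly p m = (\<Sum>k=1..p-1. monom ((- int m) ^ (p - 1 - k)) k)"

text \<open>After one t is taken out, the sum is the cofactor of t - (-m) in t^(p-1) -
  (-m)^(p-1).\<close>

lemma geom_poly_mult:
  assumes "p > 0"
  shows "[:int m, 1:] * geom_poly p m = monom 1 p - smult ((- int m) ^ (p - 1)) (monom 1 1)"
proof -
  let ?t = "monom 1 1 :: int poly"
  have "geom_poly p m = ?t * (\<Sum>i<p-1. [:- int m:] ^ (p - 1 - Suc i) * ?t ^ i)"
    unfolding geom_poly_def One_nat_def sum.atLeast1_atMost_eq sum_distrib_left
    by (intro sum.cong) (simp_all add: monom_power poly_const_pow smult_monom mult_monom)
  moreover have "[:int m, 1:] = ?t - [:- int m:]" by (simp add: monom_altdef)
  ultimately have "[:int m, 1:] * geom_poly p m = ?t * (?t ^ (p-1) - [:- int m:] ^ (p-1))"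
    by (simp only: power_diff_sumr2 mult.left_commute)
  also have "\<dots> = ?t * ?t ^ (p - 1) - smult ((- int m) ^ (p - 1)) ?t"
    by (simp add: right_diff_distrib poly_const_pow)
  also have "?t * ?t ^ (p - 1) = ?t ^ p"
    using assms by (cases p) simp_all
  finally show ?thesis by (simp add: monom_power)
qed

lemma bell_umbra_cong:
  assumes "m \<ge> 1" and "prime p" and "\<not> p dvd m"
  shows "[:int p:] dvd monom 1 m * bell_umbra (ffact_poly n * geom_poly p m)
                        - monom 1 p * reflected_derangement_poly (m + n - 1)"
proof -
  define M where "M = m + n - 1"
  \<comment> \<open>\<open>g\<close> satisfies t g = (t)_{m+n}, \<open>d\<close> is 1 modulo p by
    Fermat, and \<open>W\<close> is the product (t + m) G.\<close>
  define g where "g = pcompose (ffact_poly M) [:-1, 1 :: int:]"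
  define d where "d = (- int m) ^ (p - 1)"
  define W where "W = monom 1 p - smult d (monom 1 1)"
  let ?s = "[:- of_nat m, 1 :: int:]"
  have "int p dvd d - 1"
    using assms fermat_theorem_int[of p "- int m"] by (simp add: d_def cong_iff_dvd_diff)
  \<comment> \<open>W - (t)_p is the sum of (1 - d) t and t^p - t - (t)_p, both multiples of
    p.\<close>
  then have "[:int p:] dvd [:1 - d:] * monom 1 1"
    by (intro dvd_mult2) (simp add: dvd_diff_commute)
  then have "[:int p:] dvd [:1 - d:] * monom 1 1 + ((monom 1 p - monom 1 1) - ffact_poly p)"
    using ffact_poly_prime_dvd[OF assms(2)] by (rule dvd_add)
  also have "[:1 - d:] * monom 1 1 + ((monom 1 p - monom 1 1) - ffact_poly p) = W - ffact_poly p"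
    by (simp add: W_def smult_diff_left)
  finally have "[:int p:] dvd pcompose (W - ffact_poly p) ?s"
    by (rule const_poly_dvd_pcompose)
  \<comment> \<open>Since (t - m)_p is congruent to (t)_p, so is W(t - m).\<close>
  from dvd_add[OF this ffact_poly_shift_dvd[of p m]]
  have W: "[:int p:] dvd pcompose W ?s - ffact_poly p"
    by (simp add: pcompose_diff)

  \<comment> \<open>As t and t - p agree modulo p, g may be replaced by g(t - p), the form that
    \<open>bell_umbra_shift\<close> takes with r = p.\<close>
  have "[:int p:] dvd [:0, 1:] - [:- of_nat p, 1:]" by simp
  from pcompose_const_dvd_diff[OF this, of g]
  have "[:int p:] dvd g - pcompose g [:- of_nat p, 1:]" by (simp add: pcompose_idR)
  then have "[:int p:] dvd g * (pcompose W ?s - ffact_poly p)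
      + ffact_poly p * (g - pcompose g [:- of_nat p, 1:])"
    using W by (intro dvd_add dvd_mult)
  also have "\<dots> = g * pcompose W ?s - ffact_poly p * pcompose g [:- of_nat p, 1:]"
    by (simp add: algebra_simps)
  finally have "[:int p:] dvd bell_umbra (g * pcompose W ?s)
      - bell_umbra (ffact_poly p * pcompose g [:- of_nat p, 1:])"
    unfolding bell_umbra_diff[symmetric] by (rule bell_umbra_dvd)
  also have "bell_umbra (ffact_poly p * pcompose g [:- of_nat p, 1:])
      = monom 1 p * reflected_derangement_poly M"
    unfolding bell_umbra_shift by (simp add: g_def bell_umbra_ffact_pred)
  \<comment> \<open>Substituting t - m turns the factor t + m of W into t, and t g is (t)_{m+n} =
    (t)_m (t - m)_n.\<close>
  also have "g * pcompose W ?s = ffact_poly m * pcompose (ffact_poly n * geom_poly p m) ?s"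
  proof -
    have "pcompose W ?s = pcompose ([:int m, 1:] * geom_poly p m) ?s"
      using assms(2) by (simp only: geom_poly_mult prime_gt_0_nat W_def d_def)
    also have "\<dots> = [:0, 1:] * pcompose (geom_poly p m) ?s"
      by (simp only: pcompose_mult) (simp add: pcompose_pCons)
    finally have "g * pcompose W ?s = ([:0, 1:] * g) * pcompose (geom_poly p m) ?s"
      by (simp only: mult_ac)
    also have "[:0, 1:] * g = ffact_poly (1 + M)"
      unfolding ffact_poly_add g_def by (simp add: ffact_poly_def)
    also have "1 + M = m + n" using assms(1) by (simp add: M_def)
    finally show ?thesis by (simp only: ffact_poly_add pcompose_mult mult_ac)
  qed
  finally show ?thesis by (simp only: bell_umbra_shift M_def)
qed

lemma bell_umbra_monom_geom:
  "bell_umbra (monom 1 j * geom_poly p m)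
     = (\<Sum>k=1..p-1. smult ((- int m) ^ (p - 1 - k)) (bell_poly (j + k)))"
proof -
  have "monom 1 j * geom_poly p m = (\<Sum>k=1..p-1. smult ((- int m) ^ (p - 1 - k)) (monom 1 (j + k)))"
    by (simp add: geom_poly_def sum_distrib_left mult_monom smult_monom)
  then show ?thesis
    by (simp add: bell_umbra_sum bell_umbra_smult bell_umbra_monom)
qed

lemma bell_umbra_ffact_geom:
  "bell_umbra (ffact_poly n * geom_poly p m)
     = (\<Sum>j\<le>n. smult (signed_stirling n j)
          (\<Sum>k=1..p-1. smult ((- int m) ^ (p - 1 - k)) (bell_poly (j + k))))"
proof -
  have "ffact_poly n * geom_poly p m
      = (\<Sum>j\<le>n. smult (signed_stirling n j) (monom 1 j * geom_poly p m))"
    by (simp add: ffact_poly_eq_sum_signed_stirling sum_distrib_right smult_monom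
        flip: mult_smult_left)
  then show ?thesis
    by (simp only: bell_umbra_sum bell_umbra_smult bell_umbra_monom_geom)
qed

text \<open>Expand t^n in falling factorials and add the congruences \<open>bell_umbra_cong\<close>
  for k \<le> n with weights S(n,k).\<close>

lemma bell_umbra_monom_cong:
  assumes "m \<ge> 1" and "prime p" and "\<not> p dvd m"
  shows "[:int p:] dvd monom 1 m * bell_umbra (monom 1 n * geom_poly p m)
           - monom 1 p * (\<Sum>k\<le>n. smult (int (Stirling n k)) (reflected_derangement_poly (m + k - 1)))"
proof -
  have "monom 1 n * geom_poly p m
      = (\<Sum>k\<le>n. smult (int (Stirling n k)) (ffact_poly k * geom_poly p m))"
    by (simp add: sum_Stirling_ffact_poly[symmetric] sum_distrib_right of_nat_poly)
  then have "monom 1 m * bell_umbra (monom 1 n * geom_poly p m)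
           - monom 1 p * (\<Sum>k\<le>n. smult (int (Stirling n k)) (reflected_derangement_poly (m + k - 1)))
      = (\<Sum>k\<le>n. [:int (Stirling n k):] *
           (monom 1 m * bell_umbra (ffact_poly k * geom_poly p m)
             - monom 1 p * reflected_derangement_poly (m + k - 1)))"
    by (simp add: bell_umbra_sum bell_umbra_smult sum_distrib_left smult_diff_right sum_subtractf)
  also have "[:int p:] dvd \<dots>"
    by (intro dvd_sum dvd_mult bell_umbra_cong assms)
  finally show ?thesis .
qed

section \<open>Passage to rational coefficients\<close>

text \<open>Cross-multiplication with the reduced form; the reduced denominator is prime to the
  reduced numerator and so divides d.\<close>

lemma quotient_of_fraction:
  assumes "d \<noteq> 0"
  shows "fst (quotient_of (of_int u / of_int d)) * d = u * snd (quotient_of (of_int u / of_int d))"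
    and "snd (quotient_of (of_int u / of_int d)) dvd d"
proof -
  obtain a b where ab: "quotient_of (of_int u / of_int d) = (a, b)" by (cases "quotient_of (of_int u / of_int d)")
  then have "b > 0" "coprime a b"
    using quotient_of_denom_pos quotient_of_coprime by blast+
  moreover have "of_int u / of_int d = (of_int a / of_int b :: rat)"
    using ab by (rule quotient_of_div)
  ultimately have "(of_int (a * d) :: rat) = of_int (u * b)"
    using assms by (simp add: field_simps)
  then have eq: "a * d = u * b" by (simp only: of_int_eq_iff)
  then show "fst (quotient_of (of_int u / of_int d)) * d = u * snd (quotient_of (of_int u / of_int d))"
    by (simp add: ab)
  have "b dvd a * d" by (simp add: eq)
  with \<open>coprime a b\<close> show "snd (quotient_of (of_int u / of_int d)) dvd d"
    by (simp add: ab coprime_dvd_mult_right_iff coprime_commute)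
qed

lemma rat_p_integral_fraction:
  assumes "d \<noteq> 0" and "coprime d (int p)"
  shows "rat_p_integral p (of_int u / of_int d)"
  unfolding rat_p_integral_def
  using quotient_of_fraction(2)[OF assms(1)] assms(2) coprime_divisors[OF _ dvd_refl] by blast

text \<open>The difference is (u - v d)/d. Its reduced numerator times d is a multiple of p, and d
  is prime to p.\<close>

lemma rat_cong_fraction:
  assumes "d \<noteq> 0" and "coprime d (int p)" and "int p dvd u - v * d"
  shows "rat_cong p (of_int u / of_int d) (of_int v)"
proof -
  let ?q = "quotient_of (of_int (u - v * d) / of_int d)"
  have "int p dvd fst ?q * d"
    unfolding quotient_of_fraction(1)[OF assms(1)] using assms(3) by (rule dvd_mult2)
  then have "int p dvd fst ?q"
    using assms(2) by (simp add: coprime_dvd_mult_left_iff coprime_commute)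
  moreover have "of_int u / of_int d - of_int v = (of_int (u - v * d) / of_int d :: rat)"
    using assms(1) by (simp add: field_simps)
  moreover have "rat_p_integral p (of_int v)"
    using rat_p_integral_fraction[of 1 p v] by simp
  ultimately show ?thesis
    using rat_p_integral_fraction[OF assms(1,2), of u] by (simp add: rat_cong_def)
qed

text \<open>As d is 1 modulo p, it is prime to p and division by it keeps residues: u/d is congruent
  to u, hence to v.\<close>

lemma poly_cong_fraction:
  assumes "[:int p:] dvd U - V" and "[d = 1] (mod int p)" and "d \<noteq> 0"
    and "\<And>i. coeff P i = of_int (coeff U i) / of_int d"
    and "\<And>i. coeff Q i = of_int (coeff V i)"
  shows "poly_cong p P Q"
  unfolding poly_cong_def assms(4,5)
proof (intro allI rat_cong_fraction)
  fix i
  show "coprime d (int p)"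
    using cong_imp_coprime[OF cong_sym[OF assms(2)]] by simp
  have "int p dvd coeff U i - coeff V i"
    using assms(1) by (simp add: const_poly_dvd_iff)
  moreover have "int p dvd coeff V i * (d - 1)"
    using assms(2) by (simp add: cong_iff_dvd_diff)
  ultimately have "int p dvd (coeff U i - coeff V i) - coeff V i * (d - 1)" by (rule dvd_diff)
  then show "int p dvd coeff U i - coeff V i * d" by (simp add: algebra_simps)
qed (rule assms(3))

lemma coeff_bell_poly: "coeff (bell_poly m) i = of_nat (Stirling m i)"
proof -
  have "coeff (bell_poly m :: 'a poly) i = (\<Sum>j\<le>m. if j = i then of_nat (Stirling m i) else 0)"
    by (auto simp: bell_poly_def coeff_sum intro!: sum.cong)
  then show ?thesis by simp
qed

text \<open>The two sides differ in type: the left polynomial is over the integers, the right one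
  over the target ring.\<close>

lemma of_int_coeff_bell_poly: "of_int (coeff (bell_poly m) i) = coeff (bell_poly m) i"
  by (simp add: coeff_bell_poly)

lemma of_int_coeff_reflected_derangement_poly:
  "of_int (coeff (reflected_derangement_poly m) i) = coeff (reflected_derangement_poly m) i"
  by (simp add: coeff_reflected_derangement_poly del: of_nat_fact)

theorem theorem1p2:
  fixes n m p :: nat
  assumes "m \<ge> 1" and "prime p" and "\<not> p dvd m"
  shows "poly_cong p
           (monom 1 m * (\<Sum>k=1..p-1. smult (1 / (- of_nat m) ^ k) (bell_poly (n + k))))
           (monom 1 p * (\<Sum>k\<le>n. smult (of_nat (Stirling n k) * (-1) ^ (m + k - 1))
              (pcompose (derangement_poly (m + k - 1)) [:1, -1:])))
         \<and>
         poly_cong p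
           (monom 1 m * (\<Sum>j\<le>n. smult (of_int (signed_stirling n j))
              (\<Sum>k=1..p-1. smult (1 / (- of_nat m) ^ k) (bell_poly (j + k)))))
           (smult ((-1) ^ (m + n - 1))
              (monom 1 p * pcompose (derangement_poly (m + n - 1)) [:1, -1:]))"
proof -
  define d where "d = (- int m) ^ (p - 1)"
  have d: "[d = 1] (mod int p)"
    using assms fermat_theorem_int[of p "- int m"] by (simp add: d_def)
  have "d \<noteq> 0" using assms(1) by (simp add: d_def)
  \<comment> \<open>Over the common denominator \<open>d\<close> the inverse powers have the
    coefficients of \<open>geom_poly\<close> as numerators.\<close>
  have inv: "1 / (- of_nat m) ^ k = (of_int ((- int m) ^ (p - 1 - k)) / of_int d :: rat)"
    if "k \<in> {1..p-1}" for k
  proof -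
    have "k \<le> p - 1" using that by simp
    then have "d = (- int m) ^ (p - 1 - k) * (- int m) ^ k"
      unfolding d_def power_add[symmetric] by (simp only: le_add_diff_inverse2)
    then show ?thesis using assms(1) by simp
  qed
  have geom: "coeff (\<Sum>k=1..p-1. smult (1 / (- of_nat m) ^ k) (bell_poly (j + k))) i
      = (of_int (coeff (bell_umbra (monom 1 j * geom_poly p m)) i) / of_int d :: rat)" for j i
    unfolding bell_umbra_monom_geom coeff_sum of_int_sum sum_divide_distrib coeff_smult
    by (intro sum.cong refl)
      (simp only: inv of_int_mult of_int_coeff_bell_poly times_divide_eq_left)
  have reflected: "smult (c * (-1) ^ k) (pcompose (derangement_poly k) [:1, -1:])
      = smult c (reflected_derangement_poly k)" for c :: rat and k
    by (simp add: reflected_derangement_poly_def)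
  show ?thesis
  proof
    show "poly_cong p
           (monom 1 m * (\<Sum>k=1..p-1. smult (1 / (- of_nat m) ^ k) (bell_poly (n + k))))
           (monom 1 p * (\<Sum>k\<le>n. smult (of_nat (Stirling n k) * (-1) ^ (m + k - 1))
              (pcompose (derangement_poly (m + k - 1)) [:1, -1:])))"
    proof (rule poly_cong_fraction[OF bell_umbra_monom_cong[OF assms] d \<open>d \<noteq> 0\<close>])
      fix i
      show "coeff (monom (1::rat) m * (\<Sum>k=1..p-1. smult (1 / (- of_nat m) ^ k) (bell_poly (n + k)))) i
          = of_int (coeff (monom 1 m * bell_umbra (monom 1 n * geom_poly p m)) i) / of_int d"
        \<comment> \<open>Below degree m both coefficients are 0; from m on, the factor x^m shifts
          the index to \<open>i - m\<close>.\<close>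
        using geom[of n "i - m"] by (simp add: coeff_monom_mult)
      show "coeff (monom (1::rat) p * (\<Sum>k\<le>n. smult (of_nat (Stirling n k) * (-1) ^ (m + k - 1))
              (pcompose (derangement_poly (m + k - 1)) [:1, -1:]))) i
          = of_int (coeff (monom 1 p *
              (\<Sum>k\<le>n. smult (int (Stirling n k)) (reflected_derangement_poly (m + k - 1)))) i)"
        unfolding coeff_monom_mult reflected coeff_sum coeff_smult
        by (simp add: of_int_coeff_reflected_derangement_poly)
    qed
    \<comment> \<open>The fraction form \<open>geom\<close>, summed over j with weights
      s(n,j).\<close>
    have ffact_geom: "coeff (\<Sum>j\<le>n. smult (of_int (signed_stirling n j))
              (\<Sum>k=1..p-1. smult (1 / (- of_nat m) ^ k) (bell_poly (j + k)))) i
        = (of_int (coeff (bell_umbra (ffact_poly n * geom_poly p m)) i) / of_int d :: rat)" for i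
      unfolding bell_umbra_ffact_geom bell_umbra_monom_geom[symmetric]
        coeff_sum[of _ "{..n}"] coeff_smult geom of_int_sum sum_divide_distrib
      by simp
    show "poly_cong p
           (monom 1 m * (\<Sum>j\<le>n. smult (of_int (signed_stirling n j))
              (\<Sum>k=1..p-1. smult (1 / (- of_nat m) ^ k) (bell_poly (j + k)))))
           (smult ((-1) ^ (m + n - 1))
              (monom 1 p * pcompose (derangement_poly (m + n - 1)) [:1, -1:]))"
    proof (rule poly_cong_fraction[OF bell_umbra_cong[OF assms] d \<open>d \<noteq> 0\<close>])
      fix i
      show "coeff (monom (1::rat) m * (\<Sum>j\<le>n. smult (of_int (signed_stirling n j))
              (\<Sum>k=1..p-1. smult (1 / (- of_nat m) ^ k) (bell_poly (j + k))))) i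
          = of_int (coeff (monom 1 m * bell_umbra (ffact_poly n * geom_poly p m)) i) / of_int d"
        using ffact_geom[of "i - m"] by (simp add: coeff_monom_mult)
      show "coeff (smult ((-1::rat) ^ (m + n - 1))
              (monom 1 p * pcompose (derangement_poly (m + n - 1)) [:1, -1:])) i
          = of_int (coeff (monom 1 p * reflected_derangement_poly (m + n - 1)) i)"
        unfolding mult_smult_right[symmetric] reflected_derangement_poly_def[symmetric] coeff_monom_mult
        by (simp add: of_int_coeff_reflected_derangement_poly)
    qed
  qed
qed

end
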